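(* Let $\nu>-1$. Then for every integer $n\ge1$, $$\sum_{k \ge 1} \frac{1}{\Big[ \big(j_n^{\nu+1}\big)^2-\big(j_k^{\nu}\big)^2\Big]^2} = \frac{1}{4\big(j_n^{\nu+1}\big)^2}.$$
   Context: For $\mu>-1$, $\{j_n^{\mu}: n\ge1\}$ denotes the sequence of strictly positive zeros, in ascending order, of the Bessel function of the first kind $J_\mu$. *)

theory Defs
  imports "HOL-Analysis.Analysis"
begin

text \<open>
  Bessel function of the first kind of real order \<open>\<mu>\<close> on the positive reals. The value is only
  meaningful for \<open>x > 0\<close>, because of the real power \<open>(x / 2) powr \<mu>\<close>. The total function
  \<^const>\<open>rGamma\<close> is the reciprocal of the Gamma function, with value 0 at the poles.
\<close>
definition bessel_J :: "real \<Rightarrow> real \<Rightarrow> real" where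
  "bessel_J \<mu> x =
     (x / 2) powr \<mu> *
     (\<Sum>m. (-1) ^ m * rGamma (\<mu> + real m + 1) / fact m * (x / 2) ^ (2 * m))"

text \<open>
  For \<open>n \<ge> 1\<close>, \<open>bessel_zero \<mu> n\<close> is the \<open>n\<close>-th strictly positive zero in ascending order. The value
  0 at \<open>n = 0\<close> is not a zero in this sense; it only starts the recursion.
\<close>
primrec bessel_zero :: "real \<Rightarrow> nat \<Rightarrow> real" where
  "bessel_zero \<mu> 0 = 0"
| "bessel_zero \<mu> (Suc n) = (LEAST x. bessel_zero \<mu> n < x \<and> bessel_J \<mu> x = 0)"

end

theory Submission
  imports Defs "HOL-Complex_Analysis.Complex_Analysis" "HOL-Real_Asymp.Real_Asymp"
begin

text \<open>
  Put \<open>F\<^sub>\<nu>(z) = (\<Sum>m. (-1)^m z^m / (m! \<Gamma>(\<nu> + m + 1)))\<close>, an entire function called \<open>clifford\<close> below,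
  so that \<open>J\<^sub>\<nu>(x) = (x/2)^\<nu> F\<^sub>\<nu>(x\<^sup>2/4)\<close>. The points \<open>a\<^sub>k = (j\<^sub>k)\<^sup>2/4\<close>, for \<open>j\<^sub>k\<close> the positive zeros of
  \<open>J\<^sub>\<nu>\<close>, are exactly the complex zeros of \<open>F\<^sub>\<nu>\<close>. The theorem thus reads
  \<open>(\<Sum>k. 1 / (b - a\<^sub>k)\<^sup>2) = 1 / b\<close> for every zero \<open>b\<close> of \<open>F\<^sub>\<nu>\<^sub>+\<^sub>1\<close>.

  If \<open>F = F\<^sub>\<nu>\<close> has only simple zeros and moderate growth, differentiating its logarithmic
  derivative gives \<open>(\<Sum>k. 1 / (z - a\<^sub>k)\<^sup>2) = - (F'/F)'(z)\<close>. Since \<open>F' = - F\<^sub>\<nu>\<^sub>+\<^sub>1\<close>, the right-hand side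
  equals \<open>- F\<^sub>\<nu>\<^sub>+\<^sub>2(b) / F\<^sub>\<nu>(b)\<close> at \<open>z = b\<close>, and the recurrence \<open>F\<^sub>\<nu> = (\<nu> + 1) F\<^sub>\<nu>\<^sub>+\<^sub>1 - z F\<^sub>\<nu>\<^sub>+\<^sub>2\<close> turns
  this into \<open>1 / b\<close>.

  The partial fraction expansion (\<open>log_deriv_partial_fractions\<close>) holds for every entire function
  that is \<open>O(exp |z|)\<close>, has simple zeros and does not vanish at 0. It does not go through an
  infinite product: for each radius \<open>R\<close> the zeros of modulus at most \<open>R\<close> are divided out, and the
  logarithm of the quotient is \<open>O(R)\<close> on a disc of radius \<open>R/2\<close> by the maximum principle and the
  Borel-Caratheodory inequality. By Cauchy's estimate its second derivative at a fixed point is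
  \<open>O(1/R)\<close>. This second derivative is precisely the error in the expansion.

  The facts about the zeros are as follows. They are real by a Wronskian argument
  (\<open>clifford_zeros_real\<close>) and positive because at \<open>z \<le> 0\<close> the terms of the series are nonnegative
  and the constant term is positive. They are simple because at a common zero of \<open>F\<^sub>\<nu>\<close> and \<open>F\<^sub>\<nu>\<^sub>+\<^sub>1\<close>
  the recurrence makes all derivatives of \<open>F\<^sub>\<nu>\<close> vanish. There are infinitely many of them, since
  otherwise the partial fraction expansion would be incompatible with the recurrence as \<open>z\<close> tends
  to minus infinity (\<open>infinite_clifford_zeros\<close>). As they are also isolated, a least zero above a
  given one exists, and \<open>bessel_zero \<nu>\<close> enumerates the positive zeros of \<open>J\<^sub>\<nu>\<close>.
\<close>

section \<open>Partial fractions of logarithmic derivatives of entire functions\<close>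

text \<open>
  One zero at a time: a removable singularity is filled in at \<open>a\<close>, and the remaining points of \<open>A\<close>
  stay zeros of the quotient because \<open>1 - z / a\<close> vanishes only at \<open>a\<close>. The factors \<open>1 - z / a\<close>
  rather than \<open>z - a\<close> keep the value at 0 unchanged and have modulus at least 1 when
  \<open>|z| \<ge> 2 |a|\<close>.
\<close>
lemma divide_out_zeros:
  fixes f :: "complex \<Rightarrow> complex"
  assumes "finite A" "f holomorphic_on UNIV" "\<And>a. a \<in> A \<Longrightarrow> f a = 0" "0 \<notin> A"
  shows "\<exists>g. g holomorphic_on UNIV \<and> (\<forall>z. f z = (\<Prod>a\<in>A. 1 - z / a) * g z)"
  using assms
proof (induction A arbitrary: f rule: finite_induct)
  case empty
  then show ?case by auto
next
  case (insert a A)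
  define g where "g z = (if z = a then - a * deriv f a else f z / (1 - z / a))" for z
  have "a \<noteq> 0" using insert.prems by auto
  have "(\<lambda>z. - g z / a) holomorphic_on UNIV"
  proof (rule pole_theorem_open_0)
    show "f holomorphic_on UNIV" "open (UNIV :: complex set)" "f a = 0"
      using insert.prems by auto
    show "- g a / a = deriv f a" using \<open>a \<noteq> 0\<close> by (simp add: g_def)
    show "f z = (z - a) * (- g z / a)" if "z \<in> UNIV - {a}" for z
      using that \<open>a \<noteq> 0\<close> by (auto simp: g_def divide_simps) (simp add: algebra_simps)
  qed
  then have "(\<lambda>z. - a * (- g z / a)) holomorphic_on UNIV"
    by (intro holomorphic_on_mult holomorphic_on_const)
  then have g: "g holomorphic_on UNIV" using \<open>a \<noteq> 0\<close> by simp
  have fg: "f z = (1 - z / a) * g z" for z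
    using insert.prems \<open>a \<noteq> 0\<close> by (auto simp: g_def)
  have "g b = 0" if "b \<in> A" for b
  proof -
    have "b \<noteq> a" using that insert.hyps by auto
    then have "1 - b / a \<noteq> 0" using \<open>a \<noteq> 0\<close> by auto
    with fg[of b] insert.prems(2)[of b] that show ?thesis by auto
  qed
  then obtain h where h: "h holomorphic_on UNIV" "\<forall>z. g z = (\<Prod>a\<in>A. 1 - z / a) * h z"
    using insert.IH[OF g] insert.prems by auto
  have "\<forall>z. f z = (\<Prod>a\<in>insert a A. 1 - z / a) * h z"
    using fg h(2) insert.hyps by (simp add: mult.assoc)
  with h(1) show ?case by blast
qed

text \<open>
  The map \<open>w \<mapsto> w / (2A - w)\<close> sends the half-plane \<open>Re w < A\<close> into the unit disc and fixes 0, so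
  Schwarz's lemma applies to its composition with \<open>h\<close>, rescaled to the unit disc.
\<close>
lemma Borel_Caratheodory:
  assumes h: "h holomorphic_on ball 0 R" and h0: "h 0 = 0"
    and bound: "\<And>z. norm z < R \<Longrightarrow> Re (h z) < A"
    and z: "norm z \<le> r" and r: "r < R"
  shows "norm (h z) \<le> 2 * A * r / (R - r)"
proof -
  have R: "R > 0" and r0: "r \<ge> 0" using z r norm_ge_zero[of z] by linarith+
  have A: "A > 0" using bound[of 0] R h0 by simp
  have nz: "2 * of_real A - h w \<noteq> 0" if "norm w < R" for w
  proof
    assume "2 * of_real A - h w = 0"
    then have "h w = 2 * of_real A" by simp
    then have "Re (h w) = 2 * A" by simp
    with bound[OF that] A show False by simp
  qed
  define \<phi> where "\<phi> w = h (of_real R * w) / (2 * of_real A - h (of_real R * w))" for w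
  have sub: "norm (of_real R * w) < R" if "norm w < 1" for w :: complex
    using that R by (simp add: norm_mult)
  have comp: "(\<lambda>w. h (of_real R * w)) holomorphic_on ball 0 1"
    using holomorphic_on_compose_gen[of "\<lambda>w. of_real R * w" "ball 0 1" h "ball 0 R"] h sub
    by (auto simp: o_def image_subset_iff intro!: holomorphic_intros)
  have "norm (\<phi> w) \<le> norm w" if "norm w < 1" for w
  proof (rule Schwarz_Lemma(1))
    show "\<phi> holomorphic_on ball 0 1" unfolding \<phi>_def
      by (intro holomorphic_intros comp) (use nz sub in auto)
    show "\<phi> 0 = 0" by (simp add: \<phi>_def h0)
    show "norm (\<phi> v) < 1" if "norm v < 1" for v
    proof -
      define u where "u = h (of_real R * v)"
      have "Re u < A" using bound sub[OF that] by (simp add: u_def)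
      have "(norm (2 * of_real A - u))\<^sup>2 - (norm u)\<^sup>2 = 4 * A * (A - Re u)"
        unfolding cmod_power2 by (simp add: power2_eq_square algebra_simps)
      also have "\<dots> > 0" using A \<open>Re u < A\<close> by simp
      finally have "norm u < norm (2 * of_real A - u)"
        by (simp add: power_less_imp_less_base)
      then show ?thesis using nz[OF sub[OF that]] by (simp add: \<phi>_def u_def norm_divide)
    qed
  qed (use that in auto)
  from this[of "z / of_real R"] have "norm (\<phi> (z / of_real R)) \<le> norm (z / of_real R)"
    using z r R by (simp add: norm_divide)
  then have "norm (h z / (2 * of_real A - h z)) \<le> norm z / R"
    using R by (simp add: \<phi>_def norm_divide)
  then have 1: "norm (h z) * R \<le> norm z * norm (2 * of_real A - h z)"
    using R nz[of z] z r by (simp add: norm_divide divide_simps mult.commute)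
  have "norm (2 * of_real A - h z) \<le> 2 * A + norm (h z)"
    using norm_triangle_ineq4[of "2 * of_real A" "h z"] A by (simp add: norm_mult)
  then have "norm z * norm (2 * of_real A - h z) \<le> r * (2 * A + norm (h z))"
    using z r0 by (intro mult_mono) auto
  with 1 have "norm (h z) * (R - r) \<le> 2 * A * r" by (simp add: algebra_simps)
  then show ?thesis using r by (simp add: pos_le_divide_eq)
qed

lemma DERIV_linear_factors_exp:
  fixes h :: "complex \<Rightarrow> complex"
  assumes "finite A" "0 \<notin> A" "z \<notin> A" and h: "(h has_field_derivative h') (at z)"
  shows "((\<lambda>w. (\<Prod>a\<in>A. 1 - w / a) * exp (h w)) has_field_derivative
           (\<Prod>a\<in>A. 1 - z / a) * exp (h z) * ((\<Sum>a\<in>A. 1 / (z - a)) + h')) (at z)"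
  using assms(1-3)
proof (induction A rule: finite_induct)
  case empty
  show ?case by (auto intro!: derivative_eq_intros h)
next
  case (insert a A)
  then have IH: "((\<lambda>w. (\<Prod>a\<in>A. 1 - w / a) * exp (h w)) has_field_derivative
           (\<Prod>a\<in>A. 1 - z / a) * exp (h z) * ((\<Sum>a\<in>A. 1 / (z - a)) + h')) (at z)" by auto
  have nz: "a \<noteq> 0" "z - a \<noteq> 0" using insert.prems by auto
  have D: "((\<lambda>w. (1 - w / a) * ((\<Prod>a\<in>A. 1 - w / a) * exp (h w))) has_field_derivative
     (1 - z / a) * ((\<Prod>a\<in>A. 1 - z / a) * exp (h z) * ((\<Sum>a\<in>A. 1 / (z - a)) + h')) +
     (- 1 / a) * ((\<Prod>a\<in>A. 1 - z / a) * exp (h z))) (at z)"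
  proof (rule DERIV_mult'[OF _ IH])
    show "((\<lambda>w. 1 - w / a) has_field_derivative - 1 / a) (at z)"
      using DERIV_diff[OF DERIV_const DERIV_cdivide[OF DERIV_ident]] by simp
  qed
  have "- 1 / a = (1 - z / a) * (1 / (z - a))"
    using nz by (simp add: divide_simps)
  then have "(1 - z / a) * (p * (s + h')) + (- 1 / a) * p
      = (1 - z / a) * p * (1 / (z - a) + s + h')" for p s
    by (simp only:) (simp only: algebra_simps)
  from DERIV_cong[OF D this] show ?case
    unfolding prod.insert[OF insert.hyps] sum.insert[OF insert.hyps] by (simp only: mult.assoc)
qed

lemma finite_zeros_bounded:
  fixes f :: "complex \<Rightarrow> complex"
  assumes f: "f holomorphic_on UNIV" and f0: "f 0 \<noteq> 0"
  shows "finite {a. f a = 0 \<and> norm a \<le> R}"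
proof (cases "f constant_on UNIV")
  case True
  then have "f z \<noteq> 0" for z using f0 by (auto simp: constant_on_def)
  then show ?thesis by simp
next
  case False
  then have "finite {z \<in> cball 0 R. f z = 0}"
    by (intro holomorphic_compact_finite_zeros[OF f]) auto
  then show ?thesis by (rule rev_finite_subset) auto
qed

text \<open>
  On the circle \<open>|z| = 2R\<close> each factor \<open>1 - z / a\<close> with \<open>|a| \<le> R\<close> has modulus at least 1, so there
  the quotient is no larger than \<open>f\<close>; by the maximum principle the bound \<open>C exp (2R)\<close> holds in the
  whole disc. Simplicity of the zeros makes the quotient zero-free on the smaller disc, where it
  has a logarithm whose real part is controlled, hence whose modulus is controlled on half of that
  disc.
\<close>
lemma log_quotient_by_zeros:
  fixes f :: "complex \<Rightarrow> complex"
  assumes f: "f holomorphic_on UNIV" and f0: "f 0 \<noteq> 0"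
    and growth: "\<And>z. norm (f z) \<le> C * exp (norm z)"
    and simple: "\<And>a. f a = 0 \<Longrightarrow> deriv f a \<noteq> 0"
    and R: "R > 0"
  defines "A \<equiv> {a. f a = 0 \<and> norm a \<le> R}"
  shows "\<exists>h. h holomorphic_on ball 0 R \<and> (\<forall>z\<in>ball 0 R. f z = (\<Prod>a\<in>A. 1 - z / a) * exp (h z)) \<and>
       (\<forall>z. norm z \<le> R / 2 \<longrightarrow> norm (h z - h 0) \<le> 2 * (ln (C / norm (f 0)) + 2 * R + 1))"
proof -
  have fin: "finite A" unfolding A_def by (rule finite_zeros_bounded[OF f f0])
  have A0: "0 \<notin> A" using f0 by (auto simp: A_def)
  obtain g where g: "g holomorphic_on UNIV" and fg: "\<And>z. f z = (\<Prod>a\<in>A. 1 - z / a) * g z"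
    using divide_out_zeros[OF fin f _ A0] by (auto simp: A_def)
  have fg_fun: "f = (\<lambda>z. (\<Prod>a\<in>A. 1 - z / a) * g z)" using fg by auto
  define P where "P z = (\<Prod>a\<in>A. 1 - z / a)" for z
  have P: "P holomorphic_on UNIV" unfolding P_def by (intro holomorphic_intros) (use A0 in auto)
  have g_nz: "g z \<noteq> 0" if "z \<in> ball 0 R" for z
  proof
    assume gz: "g z = 0"
    then have fz: "f z = 0" using fg by simp
    with that have "z \<in> A" by (auto simp: A_def)
    then have "P z = 0" unfolding P_def using fin A0 by (auto intro!: prod_zero bexI[of _ z])
    have "(f has_field_derivative P z * deriv g z + deriv P z * g z) (at z)"
      unfolding fg_fun P_def[symmetric]
      by (rule DERIV_mult' holomorphic_derivI[OF P] holomorphic_derivI[OF g] open_UNIV UNIV_I)+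
    then have "deriv f z = 0" using gz \<open>P z = 0\<close> by (simp add: DERIV_imp_deriv)
    with simple fz show False by blast
  qed
  have g0: "g 0 = f 0" using fg[of 0] by simp
  have P_ge: "norm (P z) \<ge> 1" if "norm z = 2 * R" for z
  proof -
    have "norm (1 - z / a) \<ge> 1" if "a \<in> A" for a
    proof -
      have a: "a \<noteq> 0" "norm a \<le> R" using that A0 by (auto simp: A_def)
      have "norm (z / a) \<ge> 2" using a \<open>norm z = 2 * R\<close> by (simp add: norm_divide divide_simps)
      then show ?thesis using norm_triangle_ineq2[of "z / a" 1] by (simp add: norm_minus_commute)
    qed
    then have "(\<Prod>a\<in>A. norm (1 - z / a)) \<ge> 1" by (intro prod_ge_1) auto
    then show ?thesis by (simp add: P_def flip: prod_norm)
  qed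
  have g_le: "norm (g z) \<le> C * exp (2 * R)" if "z \<in> cball 0 (2 * R)" for z
  proof (rule maximum_modulus_frontier[where f = g and S = "cball 0 (2 * R)"])
    show "g holomorphic_on interior (cball 0 (2 * R))"
      by (rule holomorphic_on_subset[OF g]) auto
    show "continuous_on (closure (cball 0 (2 * R))) g"
      by (rule continuous_on_subset[OF holomorphic_on_imp_continuous_on[OF g]]) auto
    show "bounded (cball 0 (2 * R) :: complex set)" by simp
    fix z :: complex assume "z \<in> frontier (cball 0 (2 * R))"
    then have z: "norm z = 2 * R" by (simp add: frontier_cball sphere_def)
    have "norm (g z) \<le> norm (P z) * norm (g z)"
      using P_ge[OF z] by (simp add: mult_le_cancel_right1)
    also have "\<dots> = norm (f z)" by (simp add: fg P_def norm_mult)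
    also have "\<dots> \<le> C * exp (2 * R)" using growth[of z] z by simp
    finally show "norm (g z) \<le> C * exp (2 * R)" .
  qed (fact that)
  have C: "norm (f 0) \<le> C" using growth[of 0] by simp
  have C0: "C > 0" using C f0 by (meson less_le_trans zero_less_norm_iff)
  obtain h where h: "h holomorphic_on ball 0 R" and gh: "\<And>z. z \<in> ball 0 R \<Longrightarrow> g z = exp (h z)"
  proof (rule contractible_imp_holomorphic_log[of g "ball 0 R"])
    show "g holomorphic_on ball 0 R" by (rule holomorphic_on_subset[OF g]) auto
    show "contractible (ball (0::complex) R)" by (intro convex_imp_contractible convex_ball)
    show "g z \<noteq> 0" if "z \<in> ball 0 R" for z using g_nz[OF that] .
  qed blast
  \<comment> \<open>The summand 1 makes the bound on the real part strict.\<close>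
  define B where "B = ln (C / norm (f 0)) + 2 * R + 1"
  have Re_less: "Re (h z - h 0) < B" if "norm z < R" for z
  proof -
    have "exp (Re (h z - h 0)) = norm (g z) / norm (f 0)"
      using gh[of z] gh[of 0] that R g0 by (simp add: exp_diff norm_divide flip: norm_exp_eq_Re)
    also have "\<dots> \<le> C * exp (2 * R) / norm (f 0)"
      using g_le[of z] that R by (intro divide_right_mono) auto
    also have "\<dots> = exp (ln (C / norm (f 0)) + 2 * R)"
      using C0 f0 by (simp add: exp_add)
    also have "\<dots> < exp B" by (simp add: B_def)
    finally show ?thesis by simp
  qed
  have "norm (h z - h 0) \<le> 2 * B" if "norm z \<le> R / 2" for z
  proof -
    have "norm (h z - h 0) \<le> 2 * B * (R / 2) / (R - R / 2)"
      by (rule Borel_Caratheodory[of "\<lambda>z. h z - h 0" R])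
        (use h R Re_less that in \<open>auto intro!: holomorphic_intros\<close>)
    also have "\<dots> = 2 * B" using R by simp
    finally show ?thesis .
  qed
  with h gh fg show "\<exists>h. h holomorphic_on ball 0 R \<and> (\<forall>z\<in>ball 0 R. f z = (\<Prod>a\<in>A. 1 - z / a) * exp (h z)) \<and>
       (\<forall>z. norm z \<le> R / 2 \<longrightarrow> norm (h z - h 0) \<le> 2 * (ln (C / norm (f 0)) + 2 * R + 1))"
    unfolding B_def by (intro exI[of _ h]) auto
qed

text \<open>
  The left-hand side is the modulus of \<open>h''(z)\<close> for the logarithm \<open>h\<close> of the quotient by the zeros
  up to \<open>R\<close>. Cauchy's estimate on the circle of radius \<open>R/4\<close> about \<open>z\<close>, which lies in the disc of
  radius \<open>R/2\<close>, bounds it.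
\<close>
lemma log_deriv_partial_fraction_bound:
  fixes f :: "complex \<Rightarrow> complex"
  assumes f: "f holomorphic_on UNIV" and f0: "f 0 \<noteq> 0"
    and growth: "\<And>z. norm (f z) \<le> C * exp (norm z)"
    and simple: "\<And>a. f a = 0 \<Longrightarrow> deriv f a \<noteq> 0"
    and R: "R > 0" and z: "norm z < R / 4" and fz: "f z \<noteq> 0"
  shows "norm ((\<Sum>a\<in>{a. f a = 0 \<and> norm a \<le> R}. 1 / (z - a)\<^sup>2) + deriv (\<lambda>w. deriv f w / f w) z)
           \<le> 64 * (ln (C / norm (f 0)) + 2 * R + 1) / R\<^sup>2"
proof -
  define A where "A = {a. f a = 0 \<and> norm a \<le> R}"
  define B where "B = ln (C / norm (f 0)) + 2 * R + 1"
  have fin: "finite A" unfolding A_def by (rule finite_zeros_bounded[OF f f0])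
  obtain h where h: "h holomorphic_on ball 0 R"
    and fh: "\<And>z. z \<in> ball 0 R \<Longrightarrow> f z = (\<Prod>a\<in>A. 1 - z / a) * exp (h z)"
    and hB: "\<And>z. norm z \<le> R / 2 \<Longrightarrow> norm (h z - h 0) \<le> 2 * B"
    using log_quotient_by_zeros[OF f f0 growth simple R] unfolding A_def B_def by blast
  have A0: "0 \<notin> A" using f0 by (auto simp: A_def)
  have zR: "z \<in> ball 0 R" using z R by simp
  have ld: "deriv f w / f w = (\<Sum>a\<in>A. 1 / (w - a)) + deriv h w" if "w \<in> ball 0 R" "f w \<noteq> 0" for w
  proof -
    have "w \<notin> A" using that by (auto simp: A_def)
    have "(f has_field_derivative f w * ((\<Sum>a\<in>A. 1 / (w - a)) + deriv h w)) (at w)"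
      unfolding fh[OF that(1)]
      by (rule has_field_derivative_transform_within_open[
            OF DERIV_linear_factors_exp[OF fin A0 \<open>w \<notin> A\<close> holomorphic_derivI[OF h open_ball that(1)]]
            open_ball that(1)]) (simp add: fh)
    then show ?thesis using that by (simp add: DERIV_imp_deriv)
  qed
  have opn: "open {w \<in> ball 0 R. f w \<noteq> 0}"
  proof -
    have "open (f -` (- {0}))"
      using holomorphic_on_imp_continuous_on[OF f] by (intro open_vimage) auto
    then have "open (ball 0 R \<inter> f -` (- {0}))" by (intro open_Int open_ball)
    moreover have "ball 0 R \<inter> f -` (- {0}) = {w \<in> ball 0 R. f w \<noteq> 0}" by auto
    ultimately show ?thesis by simp
  qed
  have "z \<notin> A" using fz by (auto simp: A_def)
  have "((\<lambda>w. (\<Sum>a\<in>A. 1 / (w - a)) + deriv h w) has_field_derivative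
          (\<Sum>a\<in>A. - (1 / (z - a)\<^sup>2)) + deriv (deriv h) z) (at z)"
  proof (intro DERIV_add DERIV_sum)
    show "((\<lambda>w. 1 / (w - a)) has_field_derivative - (1 / (z - a)\<^sup>2)) (at z)" if "a \<in> A" for a
      using that \<open>z \<notin> A\<close> by (auto intro!: derivative_eq_intros simp: power2_eq_square)
    show "(deriv h has_field_derivative deriv (deriv h) z) (at z)"
      by (rule holomorphic_derivI[OF holomorphic_deriv[OF h open_ball] open_ball zR])
  qed
  then have "((\<lambda>w. deriv f w / f w) has_field_derivative
          (\<Sum>a\<in>A. - (1 / (z - a)\<^sup>2)) + deriv (deriv h) z) (at z)"
    by (rule has_field_derivative_transform_within_open[OF _ opn]) (use zR fz ld in auto)
  then have eq: "(\<Sum>a\<in>A. 1 / (z - a)\<^sup>2) + deriv (\<lambda>w. deriv f w / f w) z = deriv (deriv h) z"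
    by (simp add: DERIV_imp_deriv sum_negf)
  have sub: "cball z (R / 4) \<subseteq> ball 0 R"
  proof
    fix w assume "w \<in> cball z (R / 4)"
    then have "norm (w - z) \<le> R / 4" by (simp add: dist_norm norm_minus_commute)
    then show "w \<in> ball 0 R" using norm_triangle_sub[of w z] z R by simp
  qed
  have "norm ((deriv ^^ 2) (\<lambda>w. h w - h 0) z) \<le> fact 2 * (2 * B) / (R / 4) ^ 2"
  proof (rule Cauchy_inequality)
    show "(\<lambda>w. h w - h 0) holomorphic_on ball z (R / 4)"
      using order.trans[OF ball_subset_cball sub]
      by (intro holomorphic_on_diff holomorphic_on_const holomorphic_on_subset[OF h])
    show "continuous_on (cball z (R / 4)) (\<lambda>w. h w - h 0)"
      by (intro continuous_on_diff continuous_on_const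
            continuous_on_subset[OF holomorphic_on_imp_continuous_on[OF h] sub])
    show "0 < R / 4" using R by simp
    show "norm (h x - h 0) \<le> 2 * B" if "norm (z - x) = R / 4" for x
      using that z norm_triangle_sub[of x z] by (intro hB) (simp add: norm_minus_commute)
  qed
  also have "fact 2 * (2 * B) / (R / 4) ^ 2 = 64 * B / R\<^sup>2"
    by (simp add: power_divide fact_2)
  also have "(deriv ^^ 2) (\<lambda>w. h w - h 0) z = deriv (deriv h) z"
  proof -
    have "deriv (\<lambda>w. h w - h 0) w = deriv h w" if "w \<in> ball 0 R" for w
      by (intro DERIV_imp_deriv) (auto intro!: derivative_eq_intros holomorphic_derivI[OF h open_ball that])
    then have "deriv (deriv (\<lambda>w. h w - h 0)) z = deriv (deriv h) z"
      by (intro deriv_cong_ev) (use eventually_nhds_in_open[OF open_ball zR] in \<open>auto elim: eventually_mono\<close>)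
    then show ?thesis by (simp add: numeral_2_eq_2)
  qed
  finally show ?thesis using eq by (simp add: A_def B_def)
qed

text \<open>
  Exponential growth permits an extra factor \<open>exp (c z)\<close> in \<open>f\<close>, which adds a constant to the
  logarithmic derivative; differentiating once more removes it.
\<close>
theorem log_deriv_partial_fractions:
  fixes f :: "complex \<Rightarrow> complex"
  assumes f: "f holomorphic_on UNIV" and f0: "f 0 \<noteq> 0"
    and growth: "\<And>z. norm (f z) \<le> C * exp (norm z)"
    and simple: "\<And>a. f a = 0 \<Longrightarrow> deriv f a \<noteq> 0"
    and fz: "f z \<noteq> 0"
  shows "((\<lambda>R. \<Sum>a\<in>{a. f a = 0 \<and> norm a \<le> R}. 1 / (z - a)\<^sup>2) \<longlongrightarrow> - deriv (\<lambda>w. deriv f w / f w) z) at_top"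
proof -
  have "((\<lambda>R. (\<Sum>a\<in>{a. f a = 0 \<and> norm a \<le> R}. 1 / (z - a)\<^sup>2) + deriv (\<lambda>w. deriv f w / f w) z) \<longlongrightarrow> 0) at_top"
  proof (rule Lim_null_comparison)
    show "\<forall>\<^sub>F R in at_top. norm ((\<Sum>a\<in>{a. f a = 0 \<and> norm a \<le> R}. 1 / (z - a)\<^sup>2) + deriv (\<lambda>w. deriv f w / f w) z)
           \<le> 64 * (ln (C / norm (f 0)) + 2 * R + 1) / R\<^sup>2"
      using eventually_gt_at_top[of "4 * norm z"] eventually_gt_at_top[of 0]
      by eventually_elim (rule log_deriv_partial_fraction_bound[OF f f0 growth simple], use fz in auto)
    show "((\<lambda>R. 64 * (ln (C / norm (f 0)) + 2 * R + 1) / R\<^sup>2) \<longlongrightarrow> 0) at_top"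
      by real_asymp
  qed
  from tendsto_add[OF this tendsto_const[of "- deriv (\<lambda>w. deriv f w / f w) z"]] show ?thesis by simp
qed

section \<open>The Bessel-Clifford function\<close>

definition clifford_coeff :: "real \<Rightarrow> nat \<Rightarrow> real" where
  "clifford_coeff \<nu> m = (-1) ^ m * rGamma (\<nu> + real m + 1) / fact m"

text \<open>
  The classical Bessel-Clifford function at \<open>- z\<close>. For \<open>z > 0\<close> it equals
  \<open>z powr (- \<nu> / 2) * J\<^sub>\<nu>(2 sqrt z)\<close>, but unlike \<open>J\<^sub>\<nu>\<close> it is entire.
\<close>
definition clifford :: "real \<Rightarrow> complex \<Rightarrow> complex" where
  "clifford \<nu> z = (\<Sum>m. of_real (clifford_coeff \<nu> m) * z ^ m)"

lemma rGamma_shift_pos: "\<nu> > -1 \<Longrightarrow> rGamma (\<nu> + real m + 1) > 0"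
  by (simp add: rGamma_inverse_Gamma Gamma_real_pos)

text \<open>
  From the second term on, \<open>\<Gamma>\<close> is evaluated at arguments \<open>s \<ge> 1\<close> (in steps of 1), where
  \<open>\<Gamma>(s + 1) = s \<Gamma>(s) \<ge> \<Gamma>(s)\<close>. The first term needs its own bound because \<open>\<nu> + 1\<close> may lie below 1.
\<close>
lemma rGamma_shift_le:
  assumes "\<nu> > -1"
  shows "rGamma (\<nu> + real m + 1) \<le> rGamma (\<nu> + 1) + rGamma (\<nu> + 2)"
proof -
  have pos: "rGamma (\<nu> + 1) > 0" "rGamma (\<nu> + 2) > 0"
    using rGamma_shift_pos[OF assms, of 0] rGamma_shift_pos[OF assms, of 1] by (simp_all add: add.commute)
  have *: "rGamma (\<nu> + 2 + real n) \<le> rGamma (\<nu> + 2)" for n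
  proof (induction n)
    case (Suc n)
    have "1 * rGamma (\<nu> + 2 + real n + 1) \<le> (\<nu> + 2 + real n) * rGamma (\<nu> + 2 + real n + 1)"
      using assms rGamma_shift_pos[OF assms, of "Suc (Suc n)"]
      by (intro mult_right_mono) (auto simp: add_ac)
    also have "\<dots> = rGamma (\<nu> + 2 + real n)" by (rule rGamma_plus1)
    finally show ?case using Suc by (simp add: add_ac)
  qed simp
  show ?thesis
  proof (cases m)
    case 0
    then show ?thesis using pos by simp
  next
    case (Suc n)
    then show ?thesis using *[of n] pos by (simp add: add_ac)
  qed
qed

lemma norm_clifford_term_le:
  fixes z :: "'a :: {real_normed_field, banach}"
  assumes "\<nu> > -1"
  shows "norm (of_real (clifford_coeff \<nu> m) * z ^ m)
           \<le> (rGamma (\<nu> + 1) + rGamma (\<nu> + 2)) * (norm z ^ m /\<^sub>R fact m)"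
proof -
  have "norm (of_real (clifford_coeff \<nu> m) * z ^ m) = rGamma (\<nu> + real m + 1) * (norm z ^ m /\<^sub>R fact m)"
    using rGamma_shift_pos[OF assms, of m]
    by (simp add: clifford_coeff_def norm_mult norm_power abs_mult divide_simps
          del: of_real_mult of_real_divide of_real_power)
  also have "\<dots> \<le> (rGamma (\<nu> + 1) + rGamma (\<nu> + 2)) * (norm z ^ m /\<^sub>R fact m)"
    by (intro mult_right_mono rGamma_shift_le assms) auto
  finally show ?thesis .
qed

lemma summable_norm_clifford:
  fixes z :: "'a :: {real_normed_field, banach}"
  assumes "\<nu> > -1"
  shows "summable (\<lambda>m. norm (of_real (clifford_coeff \<nu> m) * z ^ m))"
proof (rule summable_comparison_test')
  show "summable (\<lambda>m. (rGamma (\<nu> + 1) + rGamma (\<nu> + 2)) * (norm z ^ m /\<^sub>R fact m))"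
    by (intro summable_mult summable_exp_generic)
  show "norm (norm (of_real (clifford_coeff \<nu> m) * z ^ m))
      \<le> (rGamma (\<nu> + 1) + rGamma (\<nu> + 2)) * (norm z ^ m /\<^sub>R fact m)" for m
    unfolding real_norm_def abs_norm_cancel by (rule norm_clifford_term_le[OF assms])
qed

lemma summable_clifford:
  fixes z :: "'a :: {real_normed_field, banach}"
  shows "\<nu> > -1 \<Longrightarrow> summable (\<lambda>m. of_real (clifford_coeff \<nu> m) * z ^ m)"
  by (rule summable_norm_cancel[OF summable_norm_clifford])

lemma norm_clifford_le:
  assumes "\<nu> > -1"
  shows "norm (clifford \<nu> z) \<le> (rGamma (\<nu> + 1) + rGamma (\<nu> + 2)) * exp (norm z)"
proof -
  have "norm (clifford \<nu> z) \<le> (\<Sum>m. norm (of_real (clifford_coeff \<nu> m) * z ^ m))"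
    unfolding clifford_def by (rule summable_norm[OF summable_norm_clifford[OF assms]])
  also have "\<dots> \<le> (\<Sum>m. (rGamma (\<nu> + 1) + rGamma (\<nu> + 2)) * (norm z ^ m /\<^sub>R fact m))"
    by (intro suminf_le norm_clifford_term_le assms summable_norm_clifford summable_mult
          summable_exp_generic)
  also have "\<dots> = (rGamma (\<nu> + 1) + rGamma (\<nu> + 2)) * exp (norm z)"
    unfolding exp_def by (rule suminf_mult[OF summable_exp_generic])
  finally show ?thesis .
qed

lemma clifford_0 [simp]: "clifford \<nu> 0 = of_real (rGamma (\<nu> + 1))"
  unfolding clifford_def powser_zero by (simp add: clifford_coeff_def)

lemma clifford_0_nonzero: "\<nu> > -1 \<Longrightarrow> clifford \<nu> 0 \<noteq> 0"
  using rGamma_shift_pos[of \<nu> 0] by simp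

lemma diffs_clifford_coeff:
  "diffs (\<lambda>m. of_real (clifford_coeff \<nu> m)) = (\<lambda>m. - of_real (clifford_coeff (\<nu> + 1) m) :: complex)"
proof
  fix m
  have "real (Suc m) * clifford_coeff \<nu> (Suc m) = - clifford_coeff (\<nu> + 1) m"
    by (simp add: clifford_coeff_def add_ac del: of_nat_Suc) (simp add: divide_simps add_ac)
  then have "of_real (real (Suc m) * clifford_coeff \<nu> (Suc m)) = (of_real (- clifford_coeff (\<nu> + 1) m) :: complex)"
    by (simp only:)
  then show "diffs (\<lambda>m. of_real (clifford_coeff \<nu> m)) m = (- of_real (clifford_coeff (\<nu> + 1) m) :: complex)"
    unfolding diffs_def by (simp only: of_real_mult of_real_minus of_real_of_nat_eq)
qed

lemma DERIV_clifford:
  assumes "\<nu> > -1"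
  shows "(clifford \<nu> has_field_derivative - clifford (\<nu> + 1) z) (at z)"
proof -
  have "((\<lambda>x. \<Sum>m. of_real (clifford_coeff \<nu> m) * x ^ m) has_field_derivative
          (\<Sum>m. diffs (\<lambda>m. of_real (clifford_coeff \<nu> m)) m * z ^ m)) (at z)"
    by (rule termdiffs_strong_converges_everywhere[OF summable_clifford[OF assms]])
  also have "(\<Sum>m. diffs (\<lambda>m. of_real (clifford_coeff \<nu> m)) m * z ^ m) = - clifford (\<nu> + 1) z"
    using suminf_minus[OF summable_clifford[of "\<nu> + 1" z]] assms
    by (simp add: diffs_clifford_coeff clifford_def)
  finally show ?thesis by (simp add: clifford_def[abs_def])
qed

lemma holomorphic_clifford: "\<nu> > -1 \<Longrightarrow> clifford \<nu> holomorphic_on UNIV"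
  using DERIV_clifford by (auto simp: holomorphic_on_open)

text \<open>
  Coefficientwise this is \<open>1/\<Gamma>(s) = s/\<Gamma>(s + 1)\<close> at \<open>s = \<nu> + m + 1\<close>, split as \<open>s = (\<nu> + 1) + m\<close>;
  the part with \<open>m\<close> is \<open>z\<close> times the derivative of \<open>F\<^sub>\<nu>\<^sub>+\<^sub>1\<close>.
\<close>
lemma clifford_recurrence:
  assumes "\<nu> > -1"
  shows "clifford \<nu> z = of_real (\<nu> + 1) * clifford (\<nu> + 1) z - z * clifford (\<nu> + 2) z"
proof -
  let ?t = "\<lambda>\<nu> m. of_real (clifford_coeff \<nu> m) * z ^ m"
  have sums: "?t \<mu> sums clifford \<mu> z" if "\<mu> > -1" for \<mu>
    unfolding clifford_def using summable_clifford[OF that] by (rule summable_sums)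
  have shift: "clifford_coeff \<nu> (Suc m) - (\<nu> + 1) * clifford_coeff (\<nu> + 1) (Suc m)
               = - clifford_coeff (\<nu> + 2) m" for m
  proof -
    have "rGamma (\<nu> + real (Suc m) + 1) = (\<nu> + real (Suc m) + 1) * rGamma (\<nu> + real m + 3)"
      using rGamma_plus1[of "\<nu> + real (Suc m) + 1"] by (simp add: add_ac)
    then have "clifford_coeff \<nu> (Suc m) - (\<nu> + 1) * clifford_coeff (\<nu> + 1) (Suc m)
      = (-1) ^ Suc m / fact (Suc m) * real (Suc m) * rGamma (\<nu> + real m + 3)"
      by (simp add: clifford_coeff_def field_simps del: fact_Suc)
    also have "\<dots> = - clifford_coeff (\<nu> + 2) m"
      by (simp add: clifford_coeff_def add_ac field_simps del: of_nat_Suc)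
    finally show ?thesis .
  qed
  have zero: "clifford_coeff \<nu> 0 - (\<nu> + 1) * clifford_coeff (\<nu> + 1) 0 = 0"
    using rGamma_plus1[of "\<nu> + 1"] by (simp add: clifford_coeff_def add_ac)
  have "(\<lambda>m. - z * ?t (\<nu> + 2) m) sums (- z * clifford (\<nu> + 2) z)"
    using assms by (intro sums_mult sums) auto
  moreover have "(\<lambda>m. - z * ?t (\<nu> + 2) m)
     = (\<lambda>m. of_real (clifford_coeff \<nu> (Suc m) - (\<nu> + 1) * clifford_coeff (\<nu> + 1) (Suc m)) * z ^ Suc m)"
    unfolding shift by (simp add: algebra_simps)
  ultimately have "(\<lambda>m. of_real (clifford_coeff \<nu> (Suc m) - (\<nu> + 1) * clifford_coeff (\<nu> + 1) (Suc m)) * z ^ Suc m)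
       sums (- z * clifford (\<nu> + 2) z)" by simp
  then have "(\<lambda>m. of_real (clifford_coeff \<nu> m - (\<nu> + 1) * clifford_coeff (\<nu> + 1) m) * z ^ m)
       sums (- z * clifford (\<nu> + 2) z)"
    by (rule sums_Suc_imp[rotated]) (simp only: zero, simp)
  moreover have "(\<lambda>m. ?t \<nu> m - of_real (\<nu> + 1) * ?t (\<nu> + 1) m)
       sums (clifford \<nu> z - of_real (\<nu> + 1) * clifford (\<nu> + 1) z)"
    using assms by (intro sums_diff sums_mult sums) auto
  moreover have "(\<lambda>m. ?t \<nu> m - of_real (\<nu> + 1) * ?t (\<nu> + 1) m)
     = (\<lambda>m. of_real (clifford_coeff \<nu> m - (\<nu> + 1) * clifford_coeff (\<nu> + 1) m) * z ^ m)"
    by (simp add: algebra_simps)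
  ultimately show ?thesis using sums_unique2 by (fastforce simp: algebra_simps)
qed

lemma clifford_of_real:
  assumes "\<nu> > -1"
  shows "clifford \<nu> (of_real x) = of_real (\<Sum>m. clifford_coeff \<nu> m * x ^ m)"
  unfolding clifford_def using summable_clifford[OF assms, of x]
  by (subst suminf_of_real) auto

lemma clifford_nonpos_real_nonzero:
  assumes "\<nu> > -1" and "x \<le> 0"
  shows "clifford \<nu> (of_real x) \<noteq> 0"
proof -
  have "clifford_coeff \<nu> m * x ^ m = rGamma (\<nu> + real m + 1) / fact m * (- x) ^ m" for m
    by (simp add: clifford_coeff_def power_minus[of x])
  moreover have "rGamma (\<nu> + real m + 1) / fact m * (- x) ^ m \<ge> 0" for m
    using rGamma_shift_pos[OF assms(1), of m] assms(2) by simp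
  ultimately have nonneg: "clifford_coeff \<nu> m * x ^ m \<ge> 0" for m by simp
  have "0 < clifford_coeff \<nu> 0 * x ^ 0"
    using rGamma_shift_pos[OF assms(1), of 0] by (simp add: clifford_coeff_def)
  then have "(\<Sum>m. clifford_coeff \<nu> m * x ^ m) > 0"
    using summable_clifford[OF assms(1), of x] nonneg by (intro suminf_pos2[of _ 0]) auto
  then show ?thesis by (simp add: clifford_of_real assms)
qed

lemma bessel_J_clifford:
  assumes "\<nu> > -1" and "x > 0"
  shows "bessel_J \<nu> x = 0 \<longleftrightarrow> clifford \<nu> (of_real (x\<^sup>2 / 4)) = 0"
proof -
  have "clifford \<nu> (of_real (x\<^sup>2 / 4)) = of_real (\<Sum>m. clifford_coeff \<nu> m * (x / 2) ^ (2 * m))"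
    unfolding clifford_of_real[OF assms(1)] by (simp add: power_mult power_divide)
  then show ?thesis using assms(2) by (simp add: bessel_J_def clifford_coeff_def)
qed

text \<open>
  The derivative of \<open>F\<^sub>\<nu>\<close> is \<open>- F\<^sub>\<nu>\<^sub>+\<^sub>1\<close>, so this says that zeros are simple. If both functions
  vanished at \<open>a\<close>, the recurrence would propagate the zero to all \<open>F\<^sub>\<nu>\<^sub>+\<^sub>n\<close>, that is, to all
  derivatives of \<open>F\<^sub>\<nu>\<close> at \<open>a\<close>, and \<open>F\<^sub>\<nu>\<close> would vanish identically.
\<close>
lemma clifford_zeros_simple:
  assumes "\<nu> > -1" and "clifford \<nu> a = 0"
  shows "clifford (\<nu> + 1) a \<noteq> 0"
proof
  assume 1: "clifford (\<nu> + 1) a = 0"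
  have a: "a \<noteq> 0" using assms clifford_0_nonzero by auto
  have "clifford (\<nu> + real n) a = 0 \<and> clifford (\<nu> + real n + 1) a = 0" for n
  proof (induction n)
    case 0
    then show ?case using assms 1 by simp
  next
    case (Suc n)
    then have "a * clifford (\<nu> + real n + 2) a = 0"
      using clifford_recurrence[of "\<nu> + real n" a] assms(1) by auto
    with a have "clifford (\<nu> + real n + 2) a = 0" by simp
    with Suc show ?case by (simp add: add_ac)
  qed
  then have all: "clifford (\<nu> + real n) a = 0" for n by blast
  have deriv: "(deriv ^^ n) (clifford \<nu>) = (\<lambda>z. (-1) ^ n * clifford (\<nu> + real n) z)" for n
  proof (induction n)
    case (Suc n)
    have "deriv (\<lambda>z. (-1) ^ n * clifford (\<nu> + real n) z) z = (-1) ^ Suc n * clifford (\<nu> + real (Suc n)) z" for z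
      by (rule DERIV_imp_deriv)
        (use assms(1) in \<open>auto intro!: derivative_eq_intros DERIV_clifford simp: add_ac\<close>)
    then show ?case by (simp add: Suc)
  qed auto
  have "clifford \<nu> 0 = 0"
    by (rule holomorphic_fun_eq_0_on_connected[OF holomorphic_clifford[OF assms(1)], of a])
      (auto simp: deriv all)
  then show False using clifford_0_nonzero[OF assms(1)] by simp
qed

text \<open>
  Lommel's argument. Along the ray \<open>t \<mapsto> \<alpha> t\<close> put \<open>u(t) = F\<^sub>\<nu>(\<alpha> t)\<close>; then \<open>u\<close> and its conjugate
  solve the same Sturm-Liouville equation with parameters \<open>\<alpha>\<close> and \<open>cnj \<alpha>\<close>. Their Wronskian,
  weighted by \<open>t powr (\<nu> + 1)\<close>, is up to a constant factor the function \<open>W\<close> of the proof, whose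
  derivative is \<open>t powr \<nu> * |u(t)|\<^sup>2\<close>. It vanishes at \<open>t = 0\<close> because \<open>\<nu> > -1\<close> and at \<open>t = 1\<close>
  because \<open>\<alpha>\<close> is a zero. A function with these end values cannot be nondecreasing on \<open>[0, 1]\<close> and
  strictly increasing near 0.
\<close>
lemma clifford_zeros_real:
  assumes \<nu>: "\<nu> > -1" and \<alpha>: "clifford \<nu> \<alpha> = 0"
  shows "Im \<alpha> = 0"
proof (rule ccontr)
  assume im: "Im \<alpha> \<noteq> 0"
  define u where "u t = clifford \<nu> (\<alpha> * of_real t)" for t :: real
  define v where "v t = clifford (\<nu> + 1) (\<alpha> * of_real t)" for t :: real
  define W where "W t = t powr (\<nu> + 1) * Im (\<alpha> * v t * cnj (u t)) / Im \<alpha>" for t :: real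
  have vder: "((\<lambda>t. clifford \<mu> (\<alpha> * of_real t)) has_vector_derivative
       - \<alpha> * clifford (\<mu> + 1) (\<alpha> * of_real t)) (at t)" if "\<mu> > -1" for \<mu> and t :: real
  proof -
    have "((\<lambda>w. clifford \<mu> (\<alpha> * w)) has_field_derivative
       - \<alpha> * clifford (\<mu> + 1) (\<alpha> * of_real t)) (at (of_real t))"
      using DERIV_chain2[OF DERIV_clifford[OF that] DERIV_cmult[OF DERIV_ident, of \<alpha>],
          of "of_real t" UNIV]
      by (simp add: mult.commute)
    then show ?thesis by (rule has_vector_derivative_real_field)
  qed
  have du: "(u has_vector_derivative - \<alpha> * v t) (at t)" for t
    unfolding u_def[abs_def] v_def by (rule vder[OF \<nu>])
  have dv: "(v has_vector_derivative - \<alpha> * clifford (\<nu> + 2) (\<alpha> * of_real t)) (at t)" for t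
    using vder[of "\<nu> + 1" t] \<nu> unfolding v_def[abs_def] by (simp add: add_ac)
  have cont: "continuous_on A u" "continuous_on A v" for A
    using du dv by (auto intro!: continuous_at_imp_continuous_on has_vector_derivative_continuous)
  have contW: "continuous_on {0..} W"
  proof -
    have "continuous_on {0..} (\<lambda>t. t powr (\<nu> + 1))"
      using \<nu> by (intro continuous_on_powr' continuous_on_id continuous_on_const) auto
    then show ?thesis
      unfolding W_def[abs_def] using im
      by (intro continuous_on_divide continuous_on_mult continuous_on_Im continuous_on_cnj
            continuous_on_const cont) auto
  qed
  have dW: "(W has_real_derivative t powr \<nu> * (norm (u t))\<^sup>2) (at t)" if "t > 0" for t
  proof -
    define w2 where "w2 = clifford (\<nu> + 2) (\<alpha> * of_real t)"
    have rec: "u t = of_real (\<nu> + 1) * v t - \<alpha> * of_real t * w2"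
      unfolding u_def v_def w2_def by (rule clifford_recurrence[OF \<nu>])
    have "((\<lambda>t. Im (\<alpha> * v t * cnj (u t))) has_real_derivative
        Im (\<alpha> * (- \<alpha> * w2) * cnj (u t) + \<alpha> * v t * cnj (- \<alpha> * v t))) (at t)"
      unfolding has_real_derivative_iff_has_vector_derivative w2_def
      by (rule has_vector_derivative_eq_rhs)
         (rule derivative_intros bounded_linear.has_vector_derivative[OF bounded_linear_Im] 
         bounded_linear.has_vector_derivative[OF bounded_linear_cnj] du dv has_vector_derivative_mult refl | simp)+
    moreover have "((\<lambda>t. t powr (\<nu> + 1)) has_real_derivative (\<nu> + 1) * t powr \<nu>) (at t)"
      using has_real_derivative_powr[OF that, of "\<nu> + 1"] by simp
    ultimately have "(W has_real_derivative
       ((\<nu> + 1) * t powr \<nu> * Im (\<alpha> * v t * cnj (u t)) +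
        Im (\<alpha> * (- \<alpha> * w2) * cnj (u t) + \<alpha> * v t * cnj (- \<alpha> * v t)) * t powr (\<nu> + 1)) / Im \<alpha>) (at t)"
      unfolding W_def[abs_def] by (intro DERIV_cdivide DERIV_mult)
    also have "t powr (\<nu> + 1) = t powr \<nu> * t" using that by (simp add: powr_add)
    also have "((\<nu> + 1) * t powr \<nu> * Im (\<alpha> * v t * cnj (u t)) +
        Im (\<alpha> * (- \<alpha> * w2) * cnj (u t) + \<alpha> * v t * cnj (- \<alpha> * v t)) * (t powr \<nu> * t)) / Im \<alpha>
       = t powr \<nu> * Im (\<alpha> * (of_real (\<nu> + 1) * v t - \<alpha> * of_real t * w2) * cnj (u t)
            - of_real t * (\<alpha> * cnj \<alpha>) * (v t * cnj (v t))) / Im \<alpha>"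
      by (simp add: algebra_simps)
    also have "of_real (\<nu> + 1) * v t - \<alpha> * of_real t * w2 = u t" using rec by simp
    also have "\<alpha> * u t * cnj (u t) - of_real t * (\<alpha> * cnj \<alpha>) * (v t * cnj (v t))
      = \<alpha> * of_real ((norm (u t))\<^sup>2) - of_real (t * (norm \<alpha>)\<^sup>2 * (norm (v t))\<^sup>2)"
      by (simp only: mult.assoc complex_norm_square[symmetric] of_real_mult)
    also have "Im \<dots> = Im \<alpha> * (norm (u t))\<^sup>2" by simp
    finally show ?thesis using im by simp
  qed
  have u0: "u 0 \<noteq> 0" unfolding u_def using clifford_0_nonzero[OF \<nu>] by simp
  have "isCont u 0" using du by (rule has_vector_derivative_continuous)
  then obtain e where e: "e > 0" "\<And>t. dist t 0 < e \<Longrightarrow> u t \<noteq> 0"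
    using continuous_at_avoid[of 0 u 0] u0 by (auto simp: dist_commute)
  define d where "d = min (1/2) (e/2)"
  have d: "0 < d" "d < 1" "d < e" using e(1) by (auto simp: d_def)
  have "W 0 < W d"
  proof (rule DERIV_pos_imp_increasing_open[OF d(1)])
    fix t assume t: "0 < t" "t < d"
    then show "\<exists>y. (W has_real_derivative y) (at t) \<and> y > 0"
      using e(2)[of t] d by (intro exI[of _ "t powr \<nu> * (norm (u t))\<^sup>2"] conjI dW) auto
  next
    show "continuous_on {0..d} W" by (rule continuous_on_subset[OF contW]) auto
  qed
  also have "W d \<le> W 1"
  proof (rule DERIV_nonneg_imp_nondecreasing[of d 1 W])
    show "\<exists>y. (W has_real_derivative y) (at t) \<and> y \<ge> 0" if "d \<le> t" "t \<le> 1" for t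
      using that d by (intro exI[of _ "t powr \<nu> * (norm (u t))\<^sup>2"] conjI dW) auto
  qed (use d in auto)
  also have "W 1 = 0" using \<alpha> by (simp add: W_def u_def)
  also have "W 0 = 0" by (simp add: W_def)
  finally show False by simp
qed

lemma clifford_zero_positive_real:
  assumes "\<nu> > -1" and "clifford \<nu> a = 0"
  shows "a = of_real (Re a)" and "Re a > 0"
proof -
  show *: "a = of_real (Re a)" using clifford_zeros_real[OF assms] by (simp add: complex_eq_iff)
  show "Re a > 0"
    using clifford_nonpos_real_nonzero[OF assms(1), of "Re a"] assms(2) * by (metis not_le)
qed

section \<open>Partial fractions for the ratio of consecutive functions\<close>

lemma DERIV_clifford_ratio:
  assumes "\<nu> > -1" and "clifford \<nu> z \<noteq> 0"
  shows "((\<lambda>w. clifford (\<nu> + 1) w / clifford \<nu> w) has_field_derivative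
           (clifford (\<nu> + 1) z / clifford \<nu> z)\<^sup>2 - clifford (\<nu> + 2) z / clifford \<nu> z) (at z)"
proof -
  have "((\<lambda>w. clifford (\<nu> + 1) w / clifford \<nu> w) has_field_derivative
     (- clifford (\<nu> + 1 + 1) z * clifford \<nu> z - clifford (\<nu> + 1) z * (- clifford (\<nu> + 1) z))
       / (clifford \<nu> z * clifford \<nu> z)) (at z)"
    using assms by (intro DERIV_divide DERIV_clifford) auto
  also have "(- clifford (\<nu> + 1 + 1) z * clifford \<nu> z - clifford (\<nu> + 1) z * (- clifford (\<nu> + 1) z))
       / (clifford \<nu> z * clifford \<nu> z)
     = (clifford (\<nu> + 1) z / clifford \<nu> z)\<^sup>2 - clifford (\<nu> + 2) z / clifford \<nu> z"
    using assms(2) by (simp add: divide_simps power2_eq_square add_ac)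
  finally show ?thesis .
qed

lemma clifford_partial_fractions:
  assumes \<nu>: "\<nu> > -1" and z: "clifford \<nu> z \<noteq> 0"
  shows "((\<lambda>R. \<Sum>a\<in>{a. clifford \<nu> a = 0 \<and> norm a \<le> R}. 1 / (z - a)\<^sup>2) \<longlongrightarrow>
           (clifford (\<nu> + 1) z / clifford \<nu> z)\<^sup>2 - clifford (\<nu> + 2) z / clifford \<nu> z) at_top"
proof -
  have d: "deriv (clifford \<nu>) w = - clifford (\<nu> + 1) w" for w
    by (rule DERIV_imp_deriv[OF DERIV_clifford[OF \<nu>]])
  have "((\<lambda>R. \<Sum>a\<in>{a. clifford \<nu> a = 0 \<and> norm a \<le> R}. 1 / (z - a)\<^sup>2) \<longlongrightarrow>
          - deriv (\<lambda>w. deriv (clifford \<nu>) w / clifford \<nu> w) z) at_top"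
    by (rule log_deriv_partial_fractions[OF holomorphic_clifford clifford_0_nonzero
          norm_clifford_le _ z]) (use \<nu> clifford_zeros_simple in \<open>auto simp: d\<close>)
  also have "- deriv (\<lambda>w. deriv (clifford \<nu>) w / clifford \<nu> w) z
      = (clifford (\<nu> + 1) z / clifford \<nu> z)\<^sup>2 - clifford (\<nu> + 2) z / clifford \<nu> z"
    using DERIV_imp_deriv[OF DERIV_minus[OF DERIV_clifford_ratio[OF \<nu> z]]] by (simp add: d)
  finally show ?thesis .
qed

text \<open>
  With finitely many zeros, \<open>q = F\<^sub>\<nu>\<^sub>+\<^sub>1 / F\<^sub>\<nu>\<close> would be \<open>c - (\<Sum>a. 1 / (z - a))\<close> on the left
  half-plane for some constant \<open>c\<close>, and it satisfies the Riccati equation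
  \<open>1 = (\<nu> + 1) q + z (q' - q\<^sup>2)\<close>. As \<open>z \<rightarrow> -\<infinity>\<close> the term \<open>z q\<^sup>2\<close> forces \<open>c = 0\<close>; but then every term
  on the right tends to 0.
\<close>
lemma infinite_clifford_zeros:
  assumes \<nu>: "\<nu> > -1"
  shows "infinite {a. clifford \<nu> a = 0}"
proof
  define Z where "Z = {a. clifford \<nu> a = 0}"
  define q where "q z = clifford (\<nu> + 1) z / clifford \<nu> z" for z
  define S1 where "S1 z = (\<Sum>a\<in>Z. 1 / (z - a))" for z
  define S2 where "S2 z = (\<Sum>a\<in>Z. 1 / (z - a)\<^sup>2)" for z
  assume "finite {a. clifford \<nu> a = 0}"
  then have fin: "finite Z" by (simp add: Z_def)
  have S2: "S2 z = (q z)\<^sup>2 - clifford (\<nu> + 2) z / clifford \<nu> z" if "clifford \<nu> z \<noteq> 0" for z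
  proof -
    have "\<forall>\<^sub>F R in at_top. \<forall>a\<in>Z. norm a \<le> R"
      using fin by (intro eventually_ball_finite) (auto intro: eventually_ge_at_top)
    then have "\<forall>\<^sub>F R in at_top. (\<Sum>a\<in>{a. clifford \<nu> a = 0 \<and> norm a \<le> R}. 1 / (z - a)\<^sup>2) = S2 z"
      by eventually_elim (auto simp: S2_def Z_def intro!: sum.cong)
    then have "((\<lambda>R. \<Sum>a\<in>{a. clifford \<nu> a = 0 \<and> norm a \<le> R}. 1 / (z - a)\<^sup>2) \<longlongrightarrow> S2 z) at_top"
      by (rule tendsto_eventually)
    then show ?thesis
      using tendsto_unique[OF _ clifford_partial_fractions[OF \<nu> that]] by (auto simp: q_def)
  qed
  define H where "H = {z. Re z < 0}"
  have H: "clifford \<nu> z \<noteq> 0" "z \<notin> Z" if "z \<in> H" for z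
    using clifford_zero_positive_real(2)[OF \<nu>, of z] that by (auto simp: H_def Z_def)
  have "\<exists>c. \<forall>z\<in>H. q z + S1 z = c"
  proof (rule has_field_derivative_zero_constant)
    show "convex H" unfolding H_def by (rule convex_halfspace_Re_lt)
    fix z assume z: "z \<in> H"
    have "(S1 has_field_derivative (\<Sum>a\<in>Z. - (1 / (z - a)\<^sup>2))) (at z)"
      unfolding S1_def[abs_def]
      by (intro DERIV_sum) (use H(2)[OF z] in \<open>auto intro!: derivative_eq_intros simp: power2_eq_square\<close>)
    then have "((\<lambda>z. q z + S1 z) has_field_derivative S2 z + (\<Sum>a\<in>Z. - (1 / (z - a)\<^sup>2))) (at z)"
      using DERIV_clifford_ratio[OF \<nu> H(1)[OF z]] S2[OF H(1)[OF z]]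
      unfolding q_def by (intro DERIV_add) auto
    then show "((\<lambda>z. q z + S1 z) has_field_derivative 0) (at z within H)"
      by (simp add: S2_def sum_negf has_field_derivative_at_within)
  qed
  then obtain c where c: "\<And>z. z \<in> H \<Longrightarrow> q z = c - S1 z" by (metis add_diff_cancel_right')
  have ode: "1 = of_real (\<nu> + 1) * q z + z * (S2 z - (q z)\<^sup>2)" if "z \<in> H" for z
  proof -
    have "1 = (of_real (\<nu> + 1) * clifford (\<nu> + 1) z - z * clifford (\<nu> + 2) z) / clifford \<nu> z"
      unfolding clifford_recurrence[OF \<nu>, of z, symmetric] using H(1)[OF that] by simp
    also have "\<dots> = of_real (\<nu> + 1) * q z - z * (clifford (\<nu> + 2) z / clifford \<nu> z)"
      by (simp add: q_def diff_divide_distrib)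
    also have "clifford (\<nu> + 2) z / clifford \<nu> z = (q z)\<^sup>2 - S2 z"
      using S2[OF H(1)[OF that]] by simp
    finally show ?thesis by (simp add: algebra_simps)
  qed
  \<comment> \<open>Limits along these points suffice; a shift by one keeps them away from 0.\<close>
  define x where "x n = (- of_nat (Suc n) :: complex)" for n
  have xH: "x n \<in> H" and x0: "x n \<noteq> 0" for n by (auto simp: x_def H_def complex_eq_iff)
  have x_inf: "filterlim x at_infinity sequentially"
  proof (rule filterlim_norm_at_top_imp_at_infinity)
    have "norm (x n) = real (Suc n)" for n by (simp add: x_def del: of_nat_Suc)
    then show "filterlim (\<lambda>n. norm (x n)) at_top sequentially"
      using filterlim_compose[OF filterlim_real_sequentially filterlim_Suc] by simp
  qed
  have inv: "(\<lambda>n. 1 / (x n - a)) \<longlonglongrightarrow> 0" for a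
    using tendsto_add_filterlim_at_infinity'[OF x_inf tendsto_const[of "- a"]]
    by (intro tendsto_divide_0[OF tendsto_const]) simp
  have x_inv: "(\<lambda>n. x n * (1 / (x n - a))) \<longlonglongrightarrow> 1" if "a \<in> Z" for a
  proof (rule Lim_transform_eventually)
    show "(\<lambda>n. 1 + a * (1 / (x n - a))) \<longlonglongrightarrow> 1"
      using tendsto_add[OF tendsto_const tendsto_mult[OF tendsto_const inv]] by fastforce
    have "x n - a \<noteq> 0" for n using H(2)[OF xH] that by auto
    then show "\<forall>\<^sub>F n in sequentially. 1 + a * (1 / (x n - a)) = x n * (1 / (x n - a))"
      by (auto simp: divide_simps)
  qed
  have S1_lim: "(\<lambda>n. S1 (x n)) \<longlonglongrightarrow> 0"
    unfolding S1_def by (rule tendsto_null_sum[OF inv])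
  have xS1_lim: "(\<lambda>n. x n * S1 (x n)) \<longlonglongrightarrow> of_nat (card Z)"
    using tendsto_sum[of Z, OF x_inv] by (simp add: S1_def sum_distrib_left)
  have xS2_lim: "(\<lambda>n. x n * S2 (x n)) \<longlonglongrightarrow> 0"
  proof -
    have "(\<lambda>n. \<Sum>a\<in>Z. x n * (1 / (x n - a)) * (1 / (x n - a))) \<longlonglongrightarrow> 0"
      by (rule tendsto_null_sum) (use tendsto_mult[OF x_inv inv] in fastforce)
    then show ?thesis by (simp add: S2_def sum_distrib_left power2_eq_square)
  qed
  \<comment> \<open>Divide the Riccati equation by \<open>z\<close> and let \<open>z\<close> run through the points \<open>x n\<close>.\<close>
  have "c = 0"
  proof -
    have x_inv0: "(\<lambda>n. 1 / x n) \<longlonglongrightarrow> 0" using inv[of 0] by simp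
    have q_lim: "(\<lambda>n. q (x n)) \<longlonglongrightarrow> c"
      using tendsto_diff[OF tendsto_const[of c] S1_lim] c[OF xH] by simp
    have "(\<lambda>n. of_real (\<nu> + 1) * q (x n) * (1 / x n) + x n * S2 (x n) * (1 / x n) - 1 / x n)
            \<longlonglongrightarrow> of_real (\<nu> + 1) * c * 0 + 0 * 0 - 0"
      by (intro tendsto_intros q_lim xS2_lim x_inv0)
    moreover have "of_real (\<nu> + 1) * q (x n) * (1 / x n) + x n * S2 (x n) * (1 / x n) - 1 / x n = (q (x n))\<^sup>2" for n
      using ode[OF xH, of n] x0[of n] by (simp add: divide_simps) (simp add: algebra_simps)
    ultimately have "(\<lambda>n. (q (x n))\<^sup>2) \<longlonglongrightarrow> 0" by simp
    then have "c\<^sup>2 = 0" using tendsto_power[OF q_lim] LIMSEQ_unique by blast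
    then show ?thesis by simp
  qed
  have "(\<lambda>n. of_real (\<nu> + 1) * (- S1 (x n)) + x n * S2 (x n) - x n * S1 (x n) * S1 (x n))
          \<longlonglongrightarrow> of_real (\<nu> + 1) * (- 0) + 0 - of_nat (card Z) * 0"
    by (intro tendsto_intros S1_lim xS1_lim xS2_lim)
  moreover have "of_real (\<nu> + 1) * (- S1 (x n)) + x n * S2 (x n) - x n * S1 (x n) * S1 (x n) = 1" for n
    using ode[OF xH, of n] c[OF xH, of n] \<open>c = 0\<close> by (simp add: algebra_simps power2_eq_square)
  ultimately show False by (simp add: LIMSEQ_const_iff)
qed

section \<open>Enumerating the positive zeros\<close>

text \<open>
  Infinitely many elements, finitely many below any bound: so there is always a least element above a
  given one. Local finiteness also prevents the increasing sequence from
  staying below an element that it misses.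
\<close>
lemma bij_betw_least_above:
  fixes e :: "nat \<Rightarrow> real" and P :: "real \<Rightarrow> bool"
  defines "Z \<equiv> {x. x > 0 \<and> P x}"
  assumes inf: "infinite Z" and fin: "\<And>r. finite (Z \<inter> {..r})"
    and e0: "e 0 = 0" and eSuc: "\<And>n. e (Suc n) = (LEAST x. e n < x \<and> P x)"
  shows "bij_betw e {1..} Z"
proof -
  have step: "e n < e (Suc n) \<and> P (e (Suc n)) \<and> (\<forall>x. e n < x \<and> P x \<longrightarrow> e (Suc n) \<le> x)"
    if "e n \<ge> 0" for n
  proof -
    have "\<not> Z \<subseteq> {..e n}" using inf fin[of "e n"] by (metis Int_absorb2)
    then obtain y where y: "y \<in> Z" "y > e n" by (metis atMost_iff not_le subsetI)
    let ?S = "Z \<inter> {..y} - {..e n}"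
    have S: "finite ?S" "?S \<noteq> {}" using fin[of y] y by auto
    have min: "Min ?S \<in> ?S" by (rule Min_in[OF S])
    have le: "Min ?S \<le> x" if x: "e n < x \<and> P x" for x
    proof (cases "x \<le> y")
      case True
      then have "x \<in> ?S" using x \<open>e n \<ge> 0\<close> by (auto simp: Z_def)
      then show ?thesis by (rule Min_le[OF S(1)])
    next
      case False
      then show ?thesis using min by auto
    qed
    have "e (Suc n) = Min ?S" unfolding eSuc
      by (rule Least_equality) (use min le in \<open>auto simp: Z_def\<close>)
    then show ?thesis using min le by (auto simp: Z_def)
  qed
  have nonneg: "e n \<ge> 0" for n
  proof (induction n)
    case (Suc n)
    then show ?case using step[OF Suc] by linarith
  qed (simp add: e0)
  note step = step[OF nonneg]
  have mono: "strict_mono e" using step by (simp add: strict_mono_Suc_iff)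
  have pos: "e (Suc n) \<in> Z" for n
    using step[of n] nonneg[of n] by (auto simp: Z_def)
  have "x \<in> e ` {1..}" if x: "x \<in> Z" for x
  proof (rule ccontr)
    assume x': "x \<notin> e ` {1..}"
    have lt: "e n < x" for n
    proof (induction n)
      case 0
      then show ?case using x by (simp add: e0 Z_def)
    next
      case (Suc n)
      then have "e (Suc n) \<le> x" using step[of n] x by (auto simp: Z_def)
      moreover have "e (Suc n) \<noteq> x" using x' by auto
      ultimately show ?case by simp
    qed
    have "range (\<lambda>n. e (Suc n)) \<subseteq> Z \<inter> {..x}" using pos lt less_imp_le by blast
    then have "finite (range (\<lambda>n. e (Suc n)))" using fin by (rule finite_subset)
    moreover have "inj (\<lambda>n. e (Suc n))"
      using strict_mono_imp_inj_on[OF mono] by (auto simp: inj_def)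
    ultimately show False using finite_imageD by blast
  qed
  moreover have "e k \<in> Z" if "k \<in> {1..}" for k
    using pos[of "k - 1"] that by simp
  ultimately show ?thesis
    using strict_mono_imp_inj_on[OF mono] by (auto simp: bij_betw_def intro: inj_on_subset)
qed

lemma bij_betw_bessel_clifford_zeros:
  assumes \<nu>: "\<nu> > -1"
  shows "bij_betw (\<lambda>x. of_real (x\<^sup>2 / 4)) {x. x > 0 \<and> bessel_J \<nu> x = 0} {a. clifford \<nu> a = 0}"
proof (rule bij_betwI[where g = "\<lambda>a. 2 * sqrt (Re a)"])
  show "(\<lambda>x. of_real (x\<^sup>2 / 4)) \<in> {x. x > 0 \<and> bessel_J \<nu> x = 0} \<rightarrow> {a. clifford \<nu> a = 0}"
    using bessel_J_clifford[OF \<nu>] by auto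
  have *: "a = of_real ((2 * sqrt (Re a))\<^sup>2 / 4)" "Re a > 0" if "clifford \<nu> a = 0" for a
    using clifford_zero_positive_real[OF \<nu> that] by (auto simp: power_mult_distrib complex_eq_iff)
  show "(\<lambda>a. 2 * sqrt (Re a)) \<in> {a. clifford \<nu> a = 0} \<rightarrow> {x. x > 0 \<and> bessel_J \<nu> x = 0}"
    using bessel_J_clifford[OF \<nu>, of "2 * sqrt (Re a)" for a] * by fastforce
  show "2 * sqrt (Re (of_real (x\<^sup>2 / 4))) = x" if "x \<in> {x. x > 0 \<and> bessel_J \<nu> x = 0}" for x
    using that by (simp add: real_sqrt_divide)
  show "of_real ((2 * sqrt (Re a))\<^sup>2 / 4) = a" if "a \<in> {a. clifford \<nu> a = 0}" for a
    using *(1)[of a] that by simp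
qed

lemma bij_betw_bessel_zero:
  assumes \<nu>: "\<nu> > -1"
  shows "bij_betw (bessel_zero \<nu>) {1..} {x. x > 0 \<and> bessel_J \<nu> x = 0}" (is "bij_betw _ _ ?Z")
proof (rule bij_betw_least_above)
  let ?c = "\<lambda>x. complex_of_real (x\<^sup>2 / 4)"
  note bij = bij_betw_bessel_clifford_zeros[OF \<nu>]
  show "infinite ?Z" using bij_betw_finite[OF bij] infinite_clifford_zeros[OF \<nu>] by blast
  show "finite (?Z \<inter> {..r})" for r
  proof (rule inj_on_finite)
    show "inj_on ?c (?Z \<inter> {..r})" using bij_betw_imp_inj_on[OF bij] by (rule inj_on_subset) auto
    show "?c ` (?Z \<inter> {..r}) \<subseteq> {a. clifford \<nu> a = 0 \<and> norm a \<le> r\<^sup>2 / 4}"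
      using bij_betwE[OF bij] by (auto simp del: of_real_divide of_real_power intro!: power_mono)
    show "finite {a. clifford \<nu> a = 0 \<and> norm a \<le> r\<^sup>2 / 4}"
      by (intro finite_zeros_bounded holomorphic_clifford clifford_0_nonzero \<nu>)
  qed
qed simp_all

section \<open>The sum over the zeros\<close>

text \<open>
  For nonnegative terms the sums along one exhaustion by finite sets bound all finite partial sums, so
  the unconditional sum exists; it must then agree with the limit along the exhaustion.
\<close>
lemma has_sum_of_exhaustion:
  fixes f g :: "'a \<Rightarrow> real"
  assumes nonneg: "\<And>a. a \<in> Z \<Longrightarrow> f a \<ge> 0"
    and fin: "\<And>R. finite {a \<in> Z. g a \<le> R}"
    and lim: "((\<lambda>R. \<Sum>a\<in>{a \<in> Z. g a \<le> R}. f a) \<longlongrightarrow> l) at_top"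
  shows "(f has_sum l) Z"
proof -
  have exhaust: "\<forall>\<^sub>F R in at_top. X \<subseteq> {a \<in> Z. g a \<le> R}" if "finite X" "X \<subseteq> Z" for X
  proof -
    have "\<forall>\<^sub>F R in at_top. \<forall>a\<in>X. g a \<le> R"
      using that(1) by (intro eventually_ball_finite) (auto intro: eventually_ge_at_top)
    then show ?thesis by eventually_elim (use that in auto)
  qed
  have "sum f X \<le> l" if "finite X" "X \<subseteq> Z" for X
  proof (rule tendsto_lowerbound[OF lim])
    show "\<forall>\<^sub>F R in at_top. sum f X \<le> (\<Sum>a\<in>{a \<in> Z. g a \<le> R}. f a)"
      using exhaust[OF that] by eventually_elim (intro sum_mono2 fin; use nonneg in auto)
  qed simp
  then have "f summable_on Z"
    by (intro nonneg_bounded_partial_sums_imp_summable_on[where C = l] nonneg)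
       (auto intro!: eventually_finite_subsets_at_top_weakI)
  then obtain s where s: "(f has_sum s) Z" by (auto simp: summable_on_def)
  have "filterlim (\<lambda>R. {a \<in> Z. g a \<le> R}) (finite_subsets_at_top Z) at_top"
    unfolding filterlim_finite_subsets_at_top
  proof (intro allI impI)
    fix X assume X: "finite X \<and> X \<subseteq> Z"
    show "\<forall>\<^sub>F R in at_top. finite {a \<in> Z. g a \<le> R} \<and> X \<subseteq> {a \<in> Z. g a \<le> R} \<and> {a \<in> Z. g a \<le> R} \<subseteq> Z"
      using exhaust[of X] X by (auto intro: fin elim: eventually_mono)
  qed
  then have "((\<lambda>R. \<Sum>a\<in>{a \<in> Z. g a \<le> R}. f a) \<longlongrightarrow> s) at_top"
    using s unfolding has_sum_def by (rule filterlim_compose[rotated])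
  with lim have "s = l" by (intro tendsto_unique[of at_top]) auto
  with s show ?thesis by simp
qed

text \<open>
  At a zero \<open>b\<close> of \<open>F\<^sub>\<nu>\<^sub>+\<^sub>1\<close> the recurrence reduces to \<open>F\<^sub>\<nu>(b) = - b F\<^sub>\<nu>\<^sub>+\<^sub>2(b)\<close>, so the expansion of the
  logarithmic derivative has the value \<open>1 / b\<close>. All zeros being real, its terms are nonnegative,
  which gives unconditional summability.
\<close>
lemma sum_over_clifford_zeros:
  assumes \<nu>: "\<nu> > -1" and b: "clifford (\<nu> + 1) (of_real b) = 0"
  shows "((\<lambda>a. 1 / (b - Re a)\<^sup>2) has_sum 1 / b) {a. clifford \<nu> a = 0}"
proof (rule has_sum_of_exhaustion)
  have Fb: "clifford \<nu> (of_real b) \<noteq> 0" using clifford_zeros_simple[OF \<nu>] b by blast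
  have "((\<lambda>R. \<Sum>a\<in>{a. clifford \<nu> a = 0 \<and> norm a \<le> R}. 1 / (of_real b - a)\<^sup>2) \<longlongrightarrow> of_real (1 / b)) at_top"
    using clifford_partial_fractions[OF \<nu> Fb] clifford_recurrence[OF \<nu>, of "of_real b"] b Fb
    by (simp add: divide_simps split: if_splits)
  from tendsto_Re[OF this] have "((\<lambda>R. \<Sum>a\<in>{a. clifford \<nu> a = 0 \<and> norm a \<le> R}. Re (1 / (of_real b - a)\<^sup>2)) \<longlongrightarrow> 1 / b) at_top"
    by simp
  moreover have "Re (1 / (of_real b - a)\<^sup>2) = 1 / (b - Re a)\<^sup>2" if "clifford \<nu> a = 0" for a
  proof -
    have "1 / (of_real b - a)\<^sup>2 = of_real (1 / (b - Re a)\<^sup>2)"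
      by (subst clifford_zero_positive_real(1)[OF \<nu> that]) simp
    then show ?thesis by (simp only: Re_complex_of_real)
  qed
  then have "(\<Sum>a\<in>{a. clifford \<nu> a = 0 \<and> norm a \<le> R}. Re (1 / (of_real b - a)\<^sup>2))
      = (\<Sum>a\<in>{a \<in> {a. clifford \<nu> a = 0}. norm a \<le> R}. 1 / (b - Re a)\<^sup>2)" for R
    by (intro sum.cong) auto
  ultimately show "((\<lambda>R. \<Sum>a\<in>{a \<in> {a. clifford \<nu> a = 0}. norm a \<le> R}. 1 / (b - Re a)\<^sup>2) \<longlongrightarrow> 1 / b) at_top"
    by (simp only:)
  show "finite {a \<in> {a. clifford \<nu> a = 0}. norm a \<le> R}" for R
    using finite_zeros_bounded[OF holomorphic_clifford[OF \<nu>] clifford_0_nonzero[OF \<nu>]] by simp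
qed simp

theorem mainTheorem5:
  fixes \<nu> :: real and n :: nat
  assumes "\<nu> > -1" and "n \<ge> 1"
  shows "((\<lambda>k. 1 / ((bessel_zero (\<nu> + 1) n)\<^sup>2 - (bessel_zero \<nu> k)\<^sup>2)\<^sup>2)
           has_sum 1 / (4 * (bessel_zero (\<nu> + 1) n)\<^sup>2)) {1..}"
proof -
  define j where "j = bessel_zero (\<nu> + 1) n"
  have "j \<in> {x. x > 0 \<and> bessel_J (\<nu> + 1) x = 0}"
    using bij_betwE[OF bij_betw_bessel_zero[of "\<nu> + 1"]] assms by (auto simp: j_def)
  then have "clifford (\<nu> + 1) (of_real (j\<^sup>2 / 4)) = 0"
    using bessel_J_clifford[of "\<nu> + 1" j] assms(1) by auto
  then have "((\<lambda>a. 1 / (j\<^sup>2 / 4 - Re a)\<^sup>2) has_sum 1 / (j\<^sup>2 / 4)) {a. clifford \<nu> a = 0}"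
    by (rule sum_over_clifford_zeros[OF assms(1)])
  then have "((\<lambda>k. 1 / (j\<^sup>2 / 4 - (bessel_zero \<nu> k)\<^sup>2 / 4)\<^sup>2) has_sum 1 / (j\<^sup>2 / 4)) {1..}"
    using has_sum_reindex_bij_betw[OF bij_betw_trans[OF bij_betw_bessel_zero[OF assms(1)]
        bij_betw_bessel_clifford_zeros[OF assms(1)]], of "\<lambda>a. 1 / (j\<^sup>2 / 4 - Re a)\<^sup>2"]
    by (simp add: o_def)
  from has_sum_cmult_right[OF this, of "1 / 16"]
  have "((\<lambda>k. 1 / 16 * (1 / (j\<^sup>2 / 4 - (bessel_zero \<nu> k)\<^sup>2 / 4)\<^sup>2)) has_sum 1 / (4 * j\<^sup>2)) {1..}"
    by simp
  moreover have "1 / 16 * (1 / (j\<^sup>2 / 4 - (bessel_zero \<nu> k)\<^sup>2 / 4)\<^sup>2) = 1 / (j\<^sup>2 - (bessel_zero \<nu> k)\<^sup>2)\<^sup>2" for k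
    by (simp flip: diff_divide_distrib add: power_divide)
  ultimately show ?thesis by (simp add: j_def)
qed

end
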